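(* Let $G$ be a finite simple graph with maximum degree $\Delta$, let $k$ be a positive integer, and let $S$ be a $K_k$-isolating set of $G$ of minimum cardinality $\iota_k(G)$, with $S\neq\emptyset$. Construct a sequence $v_1,v_2,\dots,v_\ell$ of vertices of $S$ as follows: put $S_0=S$; for $i\ge 1$, let $v_i$ be a vertex of minimum degree in the induced subgraph $G[S_{i-1}]$ and put $S_i=S_{i-1}\setminus N_G[v_i]$; stop at the first $\ell$ with $S_\ell=\emptyset$ (so that $S=\bigcup_{i=1}^{\ell}N_{S_{i-1}}[v_i]$). Then $$\iota'_k(G)\le -\frac{\iota_k(G)^2}{\ell}+\iota_k(G)(\Delta+2)-\ell\Delta .$$
   Context: For a graph $G$ and $v\in V(G)$, $N_G(v)$ is the set of neighbors of $v$, $N_G[v]=N_G(v)\cup\{v\}$; for $S\subseteq V(G)$, $N_G[S]=\bigcup_{v\in S}N_G[v]$ and $N_S[v]=N_G[v]\cap S$. $K_k$ denotes the complete graph on $k$ vertices. A set $S\subseteq V(G)$ is $K_k$-isolating if the graph $G-N_G[S]$ (obtained by deleting the vertices of $N_G[S]$) contains no subgraph isomorphic to $K_k$. The $K_k$-isolation number $\iota_k(G)$ is the minimum cardinality of a $K_k$-isolating set. A set is independent $K_k$-isolating if it is $K_k$-isolating and induces no edge; $\iota'_k(G)$ is the minimum cardinality of an independent $K_k$-isolating set. *)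

theory Defs
  imports Complex_Main "Graph_Theory.Graph_Theory"
begin

text \<open>
  A finite simple graph is a digraph satisfying the locale predicate \<^const>\<open>graph\<close>: finite,
  loop-free, without parallel arcs, and symmetric. Every undirected edge is a pair of opposite arcs,
  so the undirected degree of a vertex is its \<^const>\<open>out_degree\<close>.
\<close>

definition neighborhood :: "('a, 'b) pre_digraph \<Rightarrow> 'a \<Rightarrow> 'a set" where
  "neighborhood G v = {u. v \<rightarrow>\<^bsub>G\<^esub> u}"

definition closed_neighborhood :: "('a, 'b) pre_digraph \<Rightarrow> 'a \<Rightarrow> 'a set" where
  "closed_neighborhood G v = neighborhood G v \<union> {v}"

definition closed_neighborhood_set :: "('a, 'b) pre_digraph \<Rightarrow> 'a set \<Rightarrow> 'a set" where
  "closed_neighborhood_set G S = (\<Union>v\<in>S. closed_neighborhood G v)"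

definition max_degree :: "('a, 'b) pre_digraph \<Rightarrow> nat" where
  "max_degree G = Max (out_degree G ` verts G)"

text \<open>
  The predicate \<^const>\<open>complete_digraph\<close> is closed under isomorphism, so a subgraph isomorphic
  to the complete graph on \<open>k\<close> vertices is a subgraph satisfying it.
\<close>

definition isolating :: "('a, 'b) pre_digraph \<Rightarrow> nat \<Rightarrow> 'a set \<Rightarrow> bool" where
  "isolating G k S \<longleftrightarrow> S \<subseteq> verts G \<and>
     \<not> (\<exists>H. subgraph H (G \<restriction> (verts G - closed_neighborhood_set G S)) \<and> complete_digraph k H)"

definition independent_isolating :: "('a, 'b) pre_digraph \<Rightarrow> nat \<Rightarrow> 'a set \<Rightarrow> bool" where
  "independent_isolating G k S \<longleftrightarrow> isolating G k S \<and> arcs (G \<restriction> S) = {}"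

definition isolation_number :: "('a, 'b) pre_digraph \<Rightarrow> nat \<Rightarrow> nat" where
  "isolation_number G k = (LEAST n. \<exists>S. isolating G k S \<and> card S = n)"

definition independent_isolation_number :: "('a, 'b) pre_digraph \<Rightarrow> nat \<Rightarrow> nat" where
  "independent_isolation_number G k = (LEAST n. \<exists>S. independent_isolating G k S \<and> card S = n)"

text \<open>
  The set \<open>S\<^sub>i\<close> left after removing the closed neighbourhoods of \<open>v 1, \<dots>, v i\<close> from \<open>S\<close>; the
  value \<open>v 0\<close> is never used.
\<close>

primrec residual :: "('a, 'b) pre_digraph \<Rightarrow> 'a set \<Rightarrow> (nat \<Rightarrow> 'a) \<Rightarrow> nat \<Rightarrow> 'a set" where
  "residual G S v 0 = S"
| "residual G S v (Suc i) = residual G S v i - closed_neighborhood G (v (Suc i))"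

text \<open>
  \<open>v 1, \<dots>, v l\<close> is a possible run of the construction: ties between vertices of minimum degree in
  the induced subgraph are broken arbitrarily, and \<open>l\<close> is the first index with empty residual.
\<close>

definition greedy_sequence ::
    "('a, 'b) pre_digraph \<Rightarrow> 'a set \<Rightarrow> (nat \<Rightarrow> 'a) \<Rightarrow> nat \<Rightarrow> bool" where
  "greedy_sequence G S v l \<longleftrightarrow>
     (\<forall>i\<in>{1..l}. is_arg_min (out_degree (G \<restriction> residual G S v (i - 1)))
                   (\<lambda>u. u \<in> residual G S v (i - 1)) (v i)) \<and>
     residual G S v l = {} \<and> (\<forall>i<l. residual G S v i \<noteq> {})"

text \<open>
  For positive \<open>k\<close> both minima are over nonempty families, so the two numbers are attained.
\<close>

lemma (in graph) isolating_if_dominating: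
  assumes "k \<ge> 1" "S \<subseteq> verts G" "verts G \<subseteq> closed_neighborhood_set G S"
  shows "isolating G k S"
proof -
  have "\<not> complete_digraph k H"
    if "subgraph H (G \<restriction> (verts G - closed_neighborhood_set G S))" for H
  proof -
    have "verts H \<subseteq> verts G - closed_neighborhood_set G S"
      using that by (simp add: subgraph_def)
    then have "verts H = {}" using assms(3) by blast
    then show ?thesis using assms(1) by (simp add: complete_digraph_def)
  qed
  then show ?thesis using assms(2) by (auto simp: isolating_def)
qed

lemma (in graph) independent_isolating_exists:
  assumes "k \<ge> 1"
  shows "\<exists>S. independent_isolating G k S"
proof -
  let ?F = "{S. S \<subseteq> verts G \<and> arcs (G \<restriction> S) = {}}"
  have "finite ?F" by (rule finite_subset[of _ "Pow (verts G)"]) auto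
  moreover have "{} \<in> ?F" by (auto simp: induce_subgraph_arcs)
  ultimately obtain S where S: "S \<in> ?F" and max: "\<And>T. T \<in> ?F \<Longrightarrow> S \<subseteq> T \<Longrightarrow> T = S"
    by (metis (no_types, lifting) finite_has_maximal empty_iff)
  have "x \<in> closed_neighborhood_set G S" if x: "x \<in> verts G" for x
  proof (rule ccontr)
    assume n: "x \<notin> closed_neighborhood_set G S"
    then have "\<not> s \<rightarrow> x" if "s \<in> S" for s
      using that by (auto simp: closed_neighborhood_set_def closed_neighborhood_def neighborhood_def)
    moreover from this have "\<not> x \<rightarrow> s" if "s \<in> S" for s
      using that arcs_ends_symmetric[OF sym_arcs] by blast
    moreover have "\<not> x \<rightarrow> x" using adj_not_same by blast
    moreover have "tail G e \<rightarrow> head G e" if "e \<in> arcs G" for e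
      using that by (auto simp: arcs_ends_conv)
    ultimately have "insert x S \<in> ?F" using S x by (fastforce simp: induce_subgraph_arcs)
    then have "x \<in> S" using max by blast
    with n show False by (auto simp: closed_neighborhood_set_def closed_neighborhood_def)
  qed
  then have "isolating G k S" using assms S by (intro isolating_if_dominating) auto
  then show ?thesis using S by (auto simp: independent_isolating_def)
qed

lemma (in graph) isolation_number_attained:
  assumes "k \<ge> 1"
  shows "\<exists>S. isolating G k S \<and> card S = isolation_number G k"
    and "\<exists>S. independent_isolating G k S \<and> card S = independent_isolation_number G k"
proof -
  obtain S where S: "independent_isolating G k S" "isolating G k S"
    using independent_isolating_exists[OF assms] by (auto simp: independent_isolating_def)
  show "\<exists>S. isolating G k S \<and> card S = isolation_number G k"
    unfolding isolation_number_def by (rule LeastI[of _ "card S"]) (use S in blast)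
  show "\<exists>S. independent_isolating G k S \<and> card S = independent_isolation_number G k"
    unfolding independent_isolation_number_def by (rule LeastI[of _ "card S"]) (use S in blast)
qed

end

theory Submission
  imports Defs "HOL-Analysis.Convex"
begin

text \<open>
  The set \<open>I\<close> of all \<open>v\<^sub>i\<close> is independent and dominates \<open>S\<close>. A maximal independent subset \<open>T\<close> of
  \<open>N[S]\<close> containing \<open>I\<close> dominates \<open>N[S]\<close>, so it is isolating. Every vertex of \<open>T - I\<close> lies
  outside \<open>S\<close> and is adjacent to some vertex \<open>u \<noteq> v\<^sub>i\<close> of a block \<open>N[v\<^sub>i] \<inter> S\<^sub>i\<^sub>-\<^sub>1\<close>. If the block has
  \<open>n\<^sub>i\<close> elements, the choice of \<open>v\<^sub>i\<close> gives \<open>u\<close> at least \<open>n\<^sub>i - 1\<close> neighbours in \<open>S\<close>, hence at most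
  \<open>\<Delta> - n\<^sub>i + 1\<close> outside. So \<open>card T \<le> l + (\<Sum>i. (n\<^sub>i - 1) * (\<Delta> - n\<^sub>i + 1))\<close>, and Cauchy--Schwarz
  bounds \<open>\<Sum>i. n\<^sub>i\<^sup>2\<close> from below by \<open>(card S)\<^sup>2 / l\<close>.
\<close>

section \<open>Neighbourhoods, induced subgraphs and isolation in a simple graph\<close>

context graph
begin

lemma not_in_neighborhood_self: "u \<notin> neighborhood G u"
  using adj_not_same by (auto simp: neighborhood_def)

lemma neighborhood_sym: "u \<in> neighborhood G w \<longleftrightarrow> w \<in> neighborhood G u"
  using arcs_ends_symmetric[OF sym_arcs] by (auto simp: neighborhood_def)

lemma neighborhood_subset_verts: "neighborhood G u \<subseteq> verts G"
  by (auto simp: neighborhood_def)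

lemma finite_neighborhood: "finite (neighborhood G u)"
  using neighborhood_subset_verts finite_verts by (rule finite_subset)

lemma closed_neighborhood_set_subset_verts:
  "A \<subseteq> verts G \<Longrightarrow> closed_neighborhood_set G A \<subseteq> verts G"
  using neighborhood_subset_verts
  by (auto simp: closed_neighborhood_set_def closed_neighborhood_def)

lemma subset_closed_neighborhood_set: "A \<subseteq> closed_neighborhood_set G A"
  by (auto simp: closed_neighborhood_set_def closed_neighborhood_def)

lemma out_degree_induce_subgraph:
  assumes "u \<in> R"
  shows "out_degree (G \<restriction> R) u = card (neighborhood G u \<inter> R)"
proof -
  \<comment> \<open>There are no parallel arcs, so an arc leaving \<open>u\<close> is determined by
    its head, and counting arcs amounts to counting neighbours.\<close>
  have "inj_on (head G) (out_arcs (G \<restriction> R) u)"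
    by (auto simp: inj_on_def out_arcs_def arc_to_ends_def intro: no_multi_arcs)
  moreover have "head G ` out_arcs (G \<restriction> R) u = neighborhood G u \<inter> R"
    using assms by (force simp: neighborhood_def out_arcs_def arcs_ends_conv)
  ultimately show ?thesis
    unfolding out_degree_def by (metis card_image)
qed

lemma card_neighborhood_le_max_degree:
  assumes "u \<in> verts G"
  shows "card (neighborhood G u) \<le> max_degree G"
proof -
  have "card (neighborhood G u) = out_degree (G \<restriction> verts G) u"
    using out_degree_induce_subgraph[OF assms] neighborhood_subset_verts
    by (simp add: Int_absorb2)
  also have "\<dots> = out_degree G u"
    by (auto simp: out_degree_def out_arcs_def intro: arg_cong[where f = card])
  also have "\<dots> \<le> max_degree G"
    using assms finite_verts by (auto simp: max_degree_def)
  finally show ?thesis .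
qed

lemma arcs_induce_subgraph_empty_iff:
  "arcs (G \<restriction> A) = {} \<longleftrightarrow> (\<forall>x\<in>A. A \<inter> neighborhood G x = {})"
  by (fastforce simp: neighborhood_def arcs_ends_conv)

text \<open>Deleting more vertices leaves a subgraph of what was left before, so no new complete
  subgraph can appear. Only the closed neighbourhoods are compared; \<open>B\<close> need not
  contain \<open>A\<close>.\<close>

lemma isolating_mono:
  assumes "isolating G k A" "B \<subseteq> verts G"
    and "closed_neighborhood_set G A \<subseteq> closed_neighborhood_set G B"
  shows "isolating G k B"
proof -
  let ?X = "verts G - closed_neighborhood_set G A"
  let ?Y = "verts G - closed_neighborhood_set G B"
  have "subgraph (G \<restriction> ?Y) (G \<restriction> ?X)"
    using assms(3) wellformed_induce_subgraph by (auto simp: subgraph_def compatible_def)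
  then show ?thesis
    using assms(1,2) subgraph_trans unfolding isolating_def by blast
qed

text \<open>Take \<open>T\<close> inclusion-maximal among the independent subsets of
  \<open>C\<close> containing \<open>I\<close>: a vertex of \<open>C\<close> not dominated by
  \<open>T\<close> could be added to it.\<close>

lemma independent_extend_dominating:
  assumes "I \<subseteq> C" "finite C" "arcs (G \<restriction> I) = {}"
  obtains T where "I \<subseteq> T" "T \<subseteq> C" "arcs (G \<restriction> T) = {}" "C \<subseteq> closed_neighborhood_set G T"
proof -
  let ?F = "{T. T \<subseteq> C \<and> arcs (G \<restriction> T) = {}}"
  have "finite ?F" using assms(2) by simp
  moreover have "I \<in> ?F" using assms(1,3) by blast
  ultimately have "\<exists>T\<in>?F. I \<subseteq> T \<and> (\<forall>U\<in>?F. T \<subseteq> U \<longrightarrow> T = U)"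
    by (rule finite_has_maximal2)
  then obtain T where T: "T \<in> ?F" "I \<subseteq> T"
    and max: "\<forall>U\<in>?F. T \<subseteq> U \<longrightarrow> T = U"
    by (elim bexE conjE)
  have "x \<in> closed_neighborhood_set G T" if x: "x \<in> C" for x
  proof (rule ccontr)
    assume n: "x \<notin> closed_neighborhood_set G T"
    then have "x \<notin> neighborhood G t" "t \<notin> neighborhood G x" if "t \<in> T" for t
      using that neighborhood_sym[of x t]
      by (auto simp: closed_neighborhood_set_def closed_neighborhood_def)
    then have "insert x T \<in> ?F"
      using T x not_in_neighborhood_self[of x]
      unfolding mem_Collect_eq arcs_induce_subgraph_empty_iff by blast
    then have "x \<in> T" using max by blast
    with n show False using subset_closed_neighborhood_set by blast
  qed
  then show ?thesis using T that by blast
qed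

lemma independent_isolation_number_le:
  "independent_isolating G k T \<Longrightarrow> independent_isolation_number G k \<le> card T"
  unfolding independent_isolation_number_def by (rule Least_le) blast

end

section \<open>Decomposition of a set into residual and blocks\<close>

lemma residual_antimono:
  "i \<le> j \<Longrightarrow> residual G S v j \<subseteq> residual G S v i"
  by (induction rule: dec_induct) auto

text \<open>Blocks are indexed from \<open>0\<close>: \<open>block G S v i\<close> is the block of the greedy vertex \<open>v (Suc i)\<close>.\<close>

definition block :: "('a, 'b) pre_digraph \<Rightarrow> 'a set \<Rightarrow> (nat \<Rightarrow> 'a) \<Rightarrow> nat \<Rightarrow> 'a set" where
  "block G S v i = residual G S v i \<inter> closed_neighborhood G (v (Suc i))"

lemma block_subset: "block G S v i \<subseteq> S"
  using residual_antimono[of 0 i G S v] by (auto simp: block_def)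

lemma diff_residual_eq_blocks: "S - residual G S v n = (\<Union>i<n. block G S v i)"
proof (induction n)
  case (Suc n)
  then show ?case
    using residual_antimono[of 0 n G S v] by (auto simp: block_def lessThan_Suc)
qed simp

lemma card_eq_residual_plus_blocks:
  assumes "finite S"
  shows "card S = card (residual G S v n) + (\<Sum>i<n. card (block G S v i))"
proof (induction n)
  case (Suc n)
  have "finite (residual G S v n)"
    using assms residual_antimono[of 0 n G S v] by (simp add: finite_subset)
  then have "card (residual G S v n)
      = card (residual G S v (Suc n)) + card (block G S v n)"
    unfolding block_def residual.simps
    by (subst card_Un_disjoint[symmetric]) (auto intro: arg_cong[where f = card])
  with Suc show ?case by simp
qed simp

section \<open>The greedy sequence, its blocks and the count of an independent extension\<close>

locale greedy_run = graph G for G :: "('a, 'b) pre_digraph" +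
  fixes S :: "'a set" and v :: "nat \<Rightarrow> 'a" and l :: nat
  assumes S_verts: "S \<subseteq> verts G"
    and S_nonempty: "S \<noteq> {}"
    and greedy: "greedy_sequence G S v l"
begin

abbreviation "chosen \<equiv> (\<lambda>i. v (Suc i)) ` {..<l}"

lemma finite_S: "finite S"
  using S_verts finite_verts by (rule finite_subset)

lemma length_pos: "0 < l"
  using greedy S_nonempty by (cases l) (auto simp: greedy_sequence_def)

lemma greedy_in_residual: "i < l \<Longrightarrow> v (Suc i) \<in> residual G S v i"
  using greedy by (force simp: greedy_sequence_def is_arg_min_def)

lemma greedy_in_block: "i < l \<Longrightarrow> v (Suc i) \<in> block G S v i"
  using greedy_in_residual by (simp add: block_def closed_neighborhood_def)

lemma greedy_min_degree:
  assumes "i < l" "u \<in> residual G S v i"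
  shows "card (neighborhood G (v (Suc i)) \<inter> residual G S v i)
    \<le> card (neighborhood G u \<inter> residual G S v i)"
proof -
  have "is_arg_min (out_degree (G \<restriction> residual G S v i)) (\<lambda>u. u \<in> residual G S v i) (v (Suc i))"
    using greedy assms(1) by (force simp: greedy_sequence_def)
  then have "out_degree (G \<restriction> residual G S v i) (v (Suc i)) \<le> out_degree (G \<restriction> residual G S v i) u"
    using assms(2) by (auto simp: is_arg_min_linorder)
  then show ?thesis
    using assms greedy_in_residual by (simp add: out_degree_induce_subgraph)
qed

lemma blocks_cover: "S = (\<Union>i<l. block G S v i)"
  using greedy diff_residual_eq_blocks[of S G v l] by (simp add: greedy_sequence_def)

lemma card_eq_sum_blocks: "card S = (\<Sum>i<l. card (block G S v i))"
  using greedy card_eq_residual_plus_blocks[OF finite_S, of G v l]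
  by (simp add: greedy_sequence_def)

text \<open>The greedy vertex lies in the residual, so its block consists of itself and its
  neighbours there. Block size minus one is thus the minimum degree of the induced residual
  graph.\<close>

lemma card_block:
  assumes "i < l"
  shows "card (block G S v i) = Suc (card (neighborhood G (v (Suc i)) \<inter> residual G S v i))"
proof -
  have "block G S v i = insert (v (Suc i)) (neighborhood G (v (Suc i)) \<inter> residual G S v i)"
    using greedy_in_residual[OF assms] by (auto simp: block_def closed_neighborhood_def)
  then show ?thesis
    using not_in_neighborhood_self finite_neighborhood by simp
qed

lemma chosen_subset: "chosen \<subseteq> S"
  using greedy_in_block block_subset[of G S v] by (auto simp: subset_iff)

lemma chosen_dominates: "S \<subseteq> closed_neighborhood_set G chosen"
proof
  fix x assume "x \<in> S"
  then obtain i where "i < l" "x \<in> closed_neighborhood G (v (Suc i))"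
    using blocks_cover by (auto simp: block_def)
  then show "x \<in> closed_neighborhood_set G chosen"
    unfolding closed_neighborhood_set_def by blast
qed

text \<open>A later greedy vertex is drawn from a residual from which the closed neighbourhood of
  the earlier one has been removed.\<close>

lemma chosen_not_adjacent:
  assumes "i < j" "j < l"
  shows "v (Suc j) \<notin> neighborhood G (v (Suc i))"
proof -
  have "v (Suc j) \<in> residual G S v (Suc i)"
    using greedy_in_residual[of j] residual_antimono[of "Suc i" j G S v] assms by auto
  then show ?thesis by (simp add: closed_neighborhood_def)
qed

lemma chosen_independent: "arcs (G \<restriction> chosen) = {}"
proof -
  have "v (Suc j) \<notin> neighborhood G (v (Suc i))" if "i < l" "j < l" for i j
    using that chosen_not_adjacent[of i j] chosen_not_adjacent[of j i]
      not_in_neighborhood_self[of "v (Suc i)"] neighborhood_sym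
    by (cases i j rule: linorder_cases) auto
  then show ?thesis
    unfolding arcs_induce_subgraph_empty_iff by auto
qed

text \<open>By minimality of the greedy vertex, \<open>u\<close> has at least block size minus one
  neighbours in the residual. These lie in \<open>S\<close>, so they are disjoint from the
  neighbours outside \<open>S\<close>, and together they number at most \<Delta>.\<close>

lemma card_outer_neighborhood_le:
  assumes "i < l" "u \<in> block G S v i"
  shows "card (block G S v i) + card (neighborhood G u - S) \<le> Suc (max_degree G)"
proof -
  let ?R = "residual G S v i"
  have "u \<in> ?R" using assms(2) by (simp add: block_def)
  then have "card (block G S v i) \<le> Suc (card (neighborhood G u \<inter> ?R))"
    using card_block greedy_min_degree assms(1) by simp
  moreover have "card (neighborhood G u \<inter> ?R) + card (neighborhood G u - S)
      = card ((neighborhood G u \<inter> ?R) \<union> (neighborhood G u - S))"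
    using finite_neighborhood residual_antimono[of 0 i G S v]
    by (intro card_Un_disjoint[symmetric]) auto
  moreover have "\<dots> \<le> card (neighborhood G u)"
    by (intro card_mono finite_neighborhood) auto
  moreover have "\<dots> \<le> max_degree G"
    using assms(2) block_subset[of G S v i] S_verts
    by (intro card_neighborhood_le_max_degree) blast
  ultimately show ?thesis by linarith
qed

lemma independent_extension_subset:
  assumes "chosen \<subseteq> T" "T \<subseteq> closed_neighborhood_set G S" "arcs (G \<restriction> T) = {}"
  shows "T - chosen \<subseteq> (\<Union>i<l. \<Union>u\<in>block G S v i - {v (Suc i)}. neighborhood G u - S)"
proof
  fix x assume x: "x \<in> T - chosen"
  have indep: "y \<notin> neighborhood G x" "x \<notin> neighborhood G y" if "y \<in> T" for y
    using assms(3) that x neighborhood_sym[of x y]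
    unfolding arcs_induce_subgraph_empty_iff by blast+
  \<comment> \<open>A vertex of \<open>S\<close> is chosen or adjacent to a chosen vertex; the
    former is excluded by \<open>x\<close>, the latter by independence of \<open>T\<close>.\<close>
  have "x \<notin> S"
    using chosen_dominates indep(2) assms(1) x
    unfolding closed_neighborhood_set_def closed_neighborhood_def by blast
  moreover obtain u where u: "u \<in> S" "x \<in> closed_neighborhood G u"
    using assms(2) x by (auto simp: closed_neighborhood_set_def)
  ultimately have "x \<in> neighborhood G u - S"
    by (auto simp: closed_neighborhood_def)
  moreover obtain i where i: "i < l" "u \<in> block G S v i"
    using u blocks_cover by blast
  \<comment> \<open>Otherwise \<open>x\<close> would be adjacent to a chosen vertex, which also lies
    in \<open>T\<close>.\<close>
  moreover have "u \<noteq> v (Suc i)"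
    using calculation indep(2) assms(1) by auto
  ultimately show "x \<in> (\<Union>i<l. \<Union>u\<in>block G S v i - {v (Suc i)}. neighborhood G u - S)"
    by blast
qed

lemma card_independent_extension_le:
  assumes "chosen \<subseteq> T" "T \<subseteq> closed_neighborhood_set G S" "arcs (G \<restriction> T) = {}"
  shows "card T \<le> l + (\<Sum>i<l. (card (block G S v i) - 1) *
    (Suc (max_degree G) - card (block G S v i)))"
proof -
  let ?B = "block G S v"
  let ?U = "\<lambda>i. \<Union>u\<in>?B i - {v (Suc i)}. neighborhood G u - S"
  have finB: "finite (?B i)" for i
    using block_subset finite_S by (rule finite_subset)
  have "card (?U i) \<le> (card (?B i) - 1) * (Suc (max_degree G) - card (?B i))" if "i < l" for i
  proof -
    have "card (?U i) \<le> (\<Sum>u\<in>?B i - {v (Suc i)}. card (neighborhood G u - S))"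
      using finB by (intro card_UN_le) simp
    \<comment> \<open>Each remaining vertex of the block contributes at most \<Delta> + 1 minus the
      block size; leaving out the greedy vertex gives the factor block size minus one.\<close>
    also have "\<dots> \<le> card (?B i - {v (Suc i)}) * (Suc (max_degree G) - card (?B i))"
      using card_outer_neighborhood_le[OF that]
      by (intro sum_bounded_above[where 'a = nat, simplified]) force
    finally show ?thesis using greedy_in_block[OF that] by simp
  qed
  moreover have "card (T - chosen) \<le> card (\<Union>i<l. ?U i)"
    using independent_extension_subset[OF assms] finB finite_neighborhood
    by (intro card_mono) auto
  moreover have "\<dots> \<le> (\<Sum>i<l. card (?U i))" by (intro card_UN_le) simp
  ultimately have "card (T - chosen)
      \<le> (\<Sum>i<l. (card (?B i) - 1) * (Suc (max_degree G) - card (?B i)))"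
    by (meson lessThan_iff order_trans sum_mono)
  moreover have "card chosen \<le> l" using card_image_le[of "{..<l}" "\<lambda>i. v (Suc i)"] by simp
  moreover have "card T \<le> card chosen + card (T - chosen)"
    using card_Un_le[of chosen "T - chosen"] assms(1) by (simp add: Un_absorb1)
  ultimately show ?thesis by linarith
qed

lemma block_sum_bound:
  "real l + (\<Sum>i<l. real ((card (block G S v i) - 1) * (Suc (max_degree G) - card (block G S v i))))
    \<le> - ((real (card S))\<^sup>2 / real l) + real (card S) * (real (max_degree G) + 2)
      - real l * real (max_degree G)"
proof -
  let ?n = "\<lambda>i. real (card (block G S v i))" and ?\<Delta> = "real (max_degree G)"
  have S: "real (card S) = (\<Sum>i<l. ?n i)"
    by (simp add: card_eq_sum_blocks)
  have "real ((card (block G S v i) - 1) * (Suc (max_degree G) - card (block G S v i)))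
      = ?n i * (?\<Delta> + 2) - (?n i)\<^sup>2 - (?\<Delta> + 1)" if "i < l" for i
  proof -
    \<comment> \<open>These bounds ensure that neither natural-number subtraction truncates, so the
      product expands over the reals.\<close>
    have "1 \<le> card (block G S v i)" "card (block G S v i) \<le> Suc (max_degree G)"
      using card_block[OF that] card_outer_neighborhood_le[OF that greedy_in_block[OF that]] by auto
    then show ?thesis
      by (simp add: of_nat_diff power2_eq_square left_diff_distrib right_diff_distrib distrib_left
          del: diff_Suc_Suc diff_Suc_1)
  qed
  then have "(\<Sum>i<l. real ((card (block G S v i) - 1) * (Suc (max_degree G) - card (block G S v i))))
      = (\<Sum>i<l. ?n i * (?\<Delta> + 2) - (?n i)\<^sup>2 - (?\<Delta> + 1))"
    by (intro sum.cong) auto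
  also have "\<dots> = real (card S) * (?\<Delta> + 2) - (\<Sum>i<l. (?n i)\<^sup>2) - real l * (?\<Delta> + 1)"
    by (simp only: S sum_subtractf sum_distrib_right sum_constant card_lessThan)
  finally have "real l + (\<Sum>i<l. real ((card (block G S v i) - 1) * (Suc (max_degree G) - card (block G S v i))))
      = real (card S) * (?\<Delta> + 2) - (\<Sum>i<l. (?n i)\<^sup>2) - real l * ?\<Delta>"
    by (simp add: algebra_simps)
  \<comment> \<open>Cauchy-Schwarz for the \<open>l\<close> block sizes, whose sum is
    \<open>card S\<close>; dividing uses \<open>0 < l\<close>.\<close>
  moreover have "(real (card S))\<^sup>2 / real l \<le> (\<Sum>i<l. (?n i)\<^sup>2)"
    using sum_squared_le_sum_of_squares[of ?n "{..<l}"] length_pos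
    by (simp add: S pos_divide_le_eq mult.commute)
  ultimately show ?thesis by linarith
qed

lemma independent_isolation_number_bound:
  assumes "isolating G k S"
  shows "real (independent_isolation_number G k)
    \<le> - ((real (card S))\<^sup>2 / real l) + real (card S) * (real (max_degree G) + 2)
      - real l * real (max_degree G)"
proof -
  let ?C = "closed_neighborhood_set G S"
  have C: "?C \<subseteq> verts G" using S_verts by (rule closed_neighborhood_set_subset_verts)
  have "chosen \<subseteq> ?C" using chosen_subset subset_closed_neighborhood_set by blast
  then obtain T where T: "chosen \<subseteq> T" "T \<subseteq> ?C" "arcs (G \<restriction> T) = {}"
      "?C \<subseteq> closed_neighborhood_set G T"
    using independent_extend_dominating[OF _ finite_subset[OF C finite_verts] chosen_independent]
    by blast
  \<comment> \<open>\<open>T\<close> dominates all of N[S], so its closed neighbourhood contains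
    that of \<open>S\<close> and isolation carries over.\<close>
  have "isolating G k T"
    using assms order_trans[OF T(2) C] T(4) by (rule isolating_mono)
  then have "independent_isolation_number G k \<le> card T"
    using T by (intro independent_isolation_number_le) (simp add: independent_isolating_def)
  also have "\<dots> \<le> l + (\<Sum>i<l. (card (block G S v i) - 1) *
      (Suc (max_degree G) - card (block G S v i)))"
    using T by (intro card_independent_extension_le)
  finally have "real (independent_isolation_number G k) \<le> real l + (\<Sum>i<l.
      real ((card (block G S v i) - 1) * (Suc (max_degree G) - card (block G S v i))))"
    unfolding of_nat_add[symmetric] of_nat_sum[symmetric] of_nat_le_iff .
  then show ?thesis using block_sum_bound by linarith
qed

end

theorem theorem3:
  fixes G :: "('a, 'b) pre_digraph" and k l \<Delta> :: nat
    and S :: "'a set" and v :: "nat \<Rightarrow> 'a"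
  assumes "graph G"
    and "\<Delta> = max_degree G"
    and "k \<ge> 1"
    and "isolating G k S"
    and "card S = isolation_number G k"
    and "S \<noteq> {}"
    and "greedy_sequence G S v l"
  shows "real (independent_isolation_number G k)
    \<le> - ((real (isolation_number G k))\<^sup>2 / real l)
      + real (isolation_number G k) * (real \<Delta> + 2) - real l * real \<Delta>"
proof -
  interpret graph G by (rule assms(1))
  \<comment> \<open>The inclusion of \<open>S\<close> in the vertex set is part of
    \<open>isolating\<close>.\<close>
  interpret greedy_run G S v l
    using assms(4,6,7) by unfold_locales (auto simp: isolating_def)
  show ?thesis
    using independent_isolation_number_bound[OF assms(4)] assms(2,5) by simp
qed

end
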